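(* Let $G=(V,E)$ be a finite simple graph and let $z\in\mathbb{R}_+^E$ be nonzero. Then there exist a nonzero $w\in\mathfrak W_G(z)$ and an $\alpha_{GW}$-certificate for $(w,z)$.
   Context: For $S\subseteq V$, $\delta(S)\subseteq E$ is the set of edges with exactly one endpoint in $S$, $\chi^{\delta(S)}\in\{0,1\}^E$ its incidence vector, $\mathbf 1$ the all-ones vector, $\mathcal P(V)$ the power set. $\mathbb{S}^V_+$ is the cone of positive semidefinite symmetric $V\times V$ matrices, $A\succeq B$ means $A-B\in\mathbb{S}^V_+$, $\langle A,B\rangle=\mathrm{tr}(A^TB)$, $\mathcal L_G(w):=\sum_{ij\in E}w_{ij}(e_i-e_j)(e_i-e_j)^T$, $(\mathcal L_G^*(Y))_{ij}=Y_{ii}+Y_{jj}-Y_{ij}-Y_{ji}$ for $ij\in E$, and $\mathrm{Diag}(x)$ is the diagonal matrix with diagonal $x$. For $w,z\in\mathbb{R}_+^E$: $\mathrm{GW}(G,w):=\max\{\langle\tfrac14\mathcal L_G(w),Y\rangle : Y\in\mathbb{S}^V_+,\ \mathrm{diag}(Y)=\mathbf 1\}$; $\mathrm{GW}^\circ(G,z):=\min\{\mu:\mu\in\mathbb{R}_+,\ Y\in\mathbb{S}^V_+,\ \mathrm{diag}(Y)=\mu\mathbf 1,\ \tfrac14\mathcal L_G^*(Y)\ge z\}$. Define $\mathfrak W_G(z):=\{w\in\mathbb{R}_+^E : w^Tz=\mathrm{GW}(G,w)\,\mathrm{GW}^\circ(G,z)\}$. The constant is $\alpha_{GW}:=\min_{0<\vartheta\le\pi}\frac{2}{\pi}\frac{\vartheta}{1-\cos\vartheta}\approx0.878$.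 For $\beta\in(0,1]$, a $\beta$-certificate for $(w,z)\in\mathbb{R}_+^E\times\mathbb{R}_+^E$ is a tuple $(\rho,\mu,S,y,x)$ such that $\rho=0=\mu$ if and only if $w=0=z$, and: (i) $\rho,\mu\in\mathbb{R}_+$ and $\rho\mu=w^Tz$; (ii) $S\subseteq V$ and $w^T\chi^{\delta(S)}\ge\beta\rho$; (iii) $y\in\mathbb{R}_+^{\mathcal P(V)}$, $\sum_{U\subseteq V}y_U\chi^{\delta(U)}\ge z$ and $\mathbf 1^Ty\le\frac1\beta\mu$; (iv) $x\in\mathbb{R}^V$, $\rho\ge\mathbf 1^Tx$ and $\mathrm{Diag}(x)\succeq\tfrac14\mathcal L_G(w)$. *)

theory Defs
  imports "HOL-Analysis.Analysis"
begin

text \<open>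
  The vertex set is the finite type \<open>'v\<close>, and a simple graph is given by its set of edges,
  each edge being a two-element set of vertices.
  The set of nonnegative edge vectors consists of functions that are undefined outside \<open>E\<close>, so
  that each vector indexed by \<open>E\<close> has exactly one representative.
\<close>

definition simple_graph :: "'v::finite set set \<Rightarrow> bool" where
  "simple_graph E \<longleftrightarrow> (\<forall>e\<in>E. card e = 2)"

definition nonneg_vecs :: "'v::finite set set \<Rightarrow> ('v set \<Rightarrow> real) set" where
  "nonneg_vecs E = E \<rightarrow>\<^sub>E {0..}"

definition zero_vec :: "'v::finite set set \<Rightarrow> 'v set \<Rightarrow> real" where
  "zero_vec E = (\<lambda>e\<in>E. 0)"

definition cut_edges :: "'v::finite set set \<Rightarrow> 'v set \<Rightarrow> 'v set set" where
  "cut_edges E S = {e \<in> E. card (e \<inter> S) = 1}"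

definition psd :: "real^'v^'v::finite \<Rightarrow> bool" where
  "psd A \<longleftrightarrow> transpose A = A \<and> (\<forall>x. 0 \<le> x \<bullet> (A *v x))"

definition loewner_ge :: "real^'v^'v::finite \<Rightarrow> real^'v^'v \<Rightarrow> bool" (infix "\<succeq>" 50) where
  "A \<succeq> B \<longleftrightarrow> psd (A - B)"

definition mat_inner :: "real^'v^'v::finite \<Rightarrow> real^'v^'v \<Rightarrow> real" where
  "mat_inner A B = trace (transpose A ** B)"

definition diag :: "real^'v^'v::finite \<Rightarrow> real^'v" where
  "diag A = (\<chi> i. A $ i $ i)"

definition Diag :: "real^'v::finite \<Rightarrow> real^'v^'v" where
  "Diag x = (\<chi> i j. if i = j then x $ i else 0)"

definition outer :: "real^'v::finite \<Rightarrow> real^'v \<Rightarrow> real^'v^'v" where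
  "outer u v = (\<chi> i j. u $ i * v $ j)"

text \<open>
  The sum ranges over ordered pairs, so every edge contributes twice (its rank-one term is symmetric
  in the two endpoints); the factor \<open>1/2\<close> makes it the sum over the edges.
\<close>

definition laplacian :: "'v::finite set set \<Rightarrow> ('v set \<Rightarrow> real) \<Rightarrow> real^'v^'v" where
  "laplacian E w = (1/2) *\<^sub>R (\<Sum>(i, j) | {i, j} \<in> E.
     w {i, j} *\<^sub>R outer (axis i 1 - axis j 1) (axis i 1 - axis j 1))"

text \<open>The entry at the edge with endpoints \<open>i\<close> and \<open>j\<close>:\<close>

definition laplacian_adj :: "real^'v^'v::finite \<Rightarrow> 'v \<Rightarrow> 'v \<Rightarrow> real" where
  "laplacian_adj Y i j = Y $ i $ i + Y $ j $ j - Y $ i $ j - Y $ j $ i"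

definition GW :: "'v::finite set set \<Rightarrow> ('v set \<Rightarrow> real) \<Rightarrow> real" where
  "GW E w = (GREATEST v. \<exists>Y. psd Y \<and> diag Y = 1 \<and> v = mat_inner ((1/4) *\<^sub>R laplacian E w) Y)"

definition GW_polar :: "'v::finite set set \<Rightarrow> ('v set \<Rightarrow> real) \<Rightarrow> real" where
  "GW_polar E z = (LEAST \<mu>. 0 \<le> \<mu> \<and> (\<exists>Y. psd Y \<and> diag Y = \<mu> *\<^sub>R 1 \<and>
     (\<forall>i j. {i, j} \<in> E \<longrightarrow> z {i, j} \<le> (1/4) * laplacian_adj Y i j)))"

definition tight_weights :: "'v::finite set set \<Rightarrow> ('v set \<Rightarrow> real) \<Rightarrow> ('v set \<Rightarrow> real) set" where
  "tight_weights E z = {w \<in> nonneg_vecs E. (\<Sum>e\<in>E. w e * z e) = GW E w * GW_polar E z}"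

definition alpha_GW :: real where
  "alpha_GW = (LEAST a. \<exists>\<theta>. 0 < \<theta> \<and> \<theta> \<le> pi \<and> a = (2 / pi) * (\<theta> / (1 - cos \<theta>)))"

definition certificate ::
  "'v::finite set set \<Rightarrow> real \<Rightarrow> ('v set \<Rightarrow> real) \<Rightarrow> ('v set \<Rightarrow> real) \<Rightarrow>
   real \<Rightarrow> real \<Rightarrow> 'v set \<Rightarrow> ('v set \<Rightarrow> real) \<Rightarrow> real^'v \<Rightarrow> bool" where
  "certificate E \<beta> w z \<rho> \<mu> S y x \<longleftrightarrow>
     0 < \<beta> \<and> \<beta> \<le> 1 \<and> w \<in> nonneg_vecs E \<and> z \<in> nonneg_vecs E \<and>
     ((\<rho> = 0 \<and> \<mu> = 0) \<longleftrightarrow> (w = zero_vec E \<and> z = zero_vec E)) \<and>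
     (0 \<le> \<rho> \<and> 0 \<le> \<mu> \<and> \<rho> * \<mu> = (\<Sum>e\<in>E. w e * z e)) \<and>
     (\<Sum>e\<in>E. w e * indicator (cut_edges E S) e) \<ge> \<beta> * \<rho> \<and>
     ((\<forall>U. 0 \<le> y U) \<and> (\<forall>e\<in>E. (\<Sum>U\<in>UNIV. y U * indicator (cut_edges E U) e) \<ge> z e) \<and>
      (\<Sum>U\<in>UNIV. y U) \<le> (1 / \<beta>) * \<mu>) \<and>
     (\<rho> \<ge> (\<Sum>i\<in>UNIV. x $ i) \<and> Diag x \<succeq> (1/4) *\<^sub>R laplacian E w)"

end

theory Submission
  imports Defs
begin

text \<open>
  Let \<open>(\<mu>, Y)\<close> be optimal for the program defining the polar value of \<open>z\<close>. Separating the convex cone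
  of that program from the values below \<open>\<mu>\<close> yields at once nonnegative weights \<open>w\<close> and a vector \<open>x\<close>
  with \<open>Diag x \<succeq> (1/4) L(w)\<close> and \<open>w\<^sup>T z = (1\<^sup>T x) \<mu>\<close>; weak duality against \<open>Y / \<mu>\<close> then shows that
  \<open>1\<^sup>T x\<close> is the Goemans-Williamson value of \<open>w\<close>. Writing \<open>Y / \<mu>\<close> as a Gram matrix of unit vectors, a random
  hyperplane separates the endpoints of an edge with probability \<open>arccos (Y\<^sub>i\<^sub>j / \<mu>) / \<pi>\<close>, which is at least
  \<open>\<alpha>\<close> times \<open>(1 - Y\<^sub>i\<^sub>j / \<mu>) / 2\<close>. Scaled by \<open>\<mu> / \<alpha>\<close>, this distribution on cuts is the fractional cover
  \<open>y\<close>, and some cut is at least as heavy as the mean, which gives \<open>S\<close>.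
\<close>

subsection \<open>Random hyperplanes\<close>

text \<open>Nonnegativity turns additivity into monotonicity, which rules out the wild solutions of
  Cauchy's equation: comparison with the multiples of \<open>p / n\<close> determines
  \<open>f\<close> up to an error \<open>f p / n\<close>.\<close>

lemma additive_nonneg_linear:
  fixes f :: "real \<Rightarrow> real"
  assumes "0 < p"
    and nonneg: "\<And>t. 0 \<le> t \<Longrightarrow> t \<le> p \<Longrightarrow> 0 \<le> f t"
    and add: "\<And>s t. 0 \<le> s \<Longrightarrow> 0 \<le> t \<Longrightarrow> s + t \<le> p \<Longrightarrow> f (s + t) = f s + f t"
    and t: "0 \<le> t" "t \<le> p"
  shows "f t = t / p * f p"
proof -
  have mult: "f (real k * s) = real k * f s" if "0 \<le> s" "real k * s \<le> p" for k s
    using that(2)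
  proof (induction k)
    case 0
    then show ?case using add[of 0 0] \<open>0 < p\<close> by simp
  next
    case (Suc k)
    then have "real k * s + s \<le> p" by (simp add: algebra_simps)
    with Suc add[of "real k * s" s] that(1) show ?case by (simp add: algebra_simps)
  qed
  have approx: "s / p * f p \<le> f s + f p / real n" if s: "0 \<le> s" "s \<le> p" and n: "0 < n" for s n
  proof -
    \<comment> \<open>A grid of mesh \<open>p / n\<close>, with \<open>k * d\<close> the last grid
      point not beyond \<open>s\<close>.\<close>
    define d where "d = p / real n"
    define k where "k = nat \<lfloor>s / d\<rfloor>"
    have "0 < d" using \<open>0 < p\<close> n by (simp add: d_def)
    have k: "real k \<le> s / d" "s / d < real k + 1"
      using s \<open>0 < d\<close> by (auto simp: k_def of_nat_nat)
    have kd: "real k * d \<le> s" using k \<open>0 < d\<close> by (simp add: field_simps)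
    have kd0: "0 \<le> real k * d" using \<open>0 < d\<close> by simp
    have "f p = real n * f d"
      using mult[of d n] \<open>0 < d\<close> n by (simp add: d_def)
    then have fd: "f d = f p / real n" using n by (simp add: field_simps)
    have "s / p = (s / d) / real n" using n by (simp add: d_def)
    also have "\<dots> \<le> (real k + 1) / real n" using k by (intro divide_right_mono) auto
    finally have "s / p * f p \<le> (real k + 1) / real n * f p"
      using nonneg[of p] \<open>0 < p\<close> by (intro mult_right_mono) auto
    also have "\<dots> = real k * f d + f p / real n"
      by (simp add: fd add_divide_distrib algebra_simps)
    also have "real k * f d = f (real k * d)"
      using mult[of d k] kd s \<open>0 < d\<close> by simp
    also have "f (real k * d) \<le> f s"
      using add[of "real k * d" "s - real k * d"] nonneg[of "s - real k * d"] kd s kd0 by force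
    finally show ?thesis by simp
  qed
  have lower: "s / p * f p \<le> f s" if s: "0 \<le> s" "s \<le> p" for s
  proof (rule LIMSEQ_le_const)
    show "(\<lambda>n. f s + f p / real n) \<longlonglongrightarrow> f s"
      using tendsto_add[OF tendsto_const lim_const_over_n, of "f s" "f p"] by simp
    show "\<exists>N. \<forall>n\<ge>N. s / p * f p \<le> f s + f p / real n"
      using approx[OF s] by (intro exI[of _ 1]) simp
  qed
  \<comment> \<open>The lower bounds at \<open>t\<close> and \<open>p - t\<close> add up to
    \<open>f p\<close> exactly, so neither can be strict.\<close>
  have "f p = f t + f (p - t)" using add[of t "p - t"] t by simp
  moreover have "(p - t) / p * f p = f p - t / p * f p"
    using \<open>0 < p\<close> by (simp add: field_simps)
  ultimately show ?thesis using lower[of t] lower[of "p - t"] t by simp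
qed

text \<open>With the unit ball for the random normal vector, the measure of a wedge spanned by two unit vectors
  in a fixed plane is rotation invariant and additive in the angle, hence proportional to it.\<close>

definition wedge :: "'a::euclidean_space \<Rightarrow> 'a \<Rightarrow> 'a set" where
  "wedge u v = {g \<in> ball 0 1. (0 < g \<bullet> u) \<noteq> (0 < g \<bullet> v)}"

lemma ball_halfspace_lmeasurable:
  fixes u :: "'a::euclidean_space"
  shows "{g \<in> ball 0 1. 0 < g \<bullet> u} \<in> lmeasurable"
proof -
  have "open {g. 0 < g \<bullet> u}" 
    using open_halfspace_gt[of 0 u] by (simp add: inner_commute)
  then have "ball 0 1 \<inter> {g. 0 < g \<bullet> u} \<in> lmeasurable"
    by (intro lmeasurable_open bounded_Int open_Int) auto
  then show ?thesis by (simp add: Int_def)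
qed

lemma wedge_lmeasurable: "wedge u v \<in> lmeasurable"
proof -
  define A where "A w = {g \<in> ball (0::'a) 1. 0 < g \<bullet> w}" for w
  have "wedge u v = (A u - A v) \<union> (A v - A u)"
    by (auto simp: wedge_def A_def)
  moreover have "A w \<in> lmeasurable" for w
    using ball_halfspace_lmeasurable by (simp add: A_def)
  ultimately show ?thesis
    by (simp add: fmeasurable.Un fmeasurable.Diff fmeasurableD)
qed

lemma measure_wedge_orthogonal:
  fixes f :: "real^'n::{finite,wellorder} \<Rightarrow> real^'n::_"
  assumes f: "orthogonal_transformation f"
  shows "measure lebesgue (wedge (f u) (f v)) = measure lebesgue (wedge u v)"
proof -
  have "wedge (f u) (f v) = f ` wedge u v"
  proof (intro equalityI subsetI)
    fix g assume g: "g \<in> wedge (f u) (f v)"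
    obtain h where "g = f h" using orthogonal_transformation_surj[OF f] by auto
    with g f show "g \<in> f ` wedge u v"
      by (auto simp: wedge_def orthogonal_transformation_def orthogonal_transformation_norm)
  qed (use f in \<open>auto simp: wedge_def orthogonal_transformation_def orthogonal_transformation_norm\<close>)
  then show ?thesis
    using measure_orthogonal_image[OF f wedge_lmeasurable] by simp
qed

definition plane_point :: "'a::real_vector \<Rightarrow> 'a \<Rightarrow> real \<Rightarrow> 'a" where
  "plane_point a b t = cos t *\<^sub>R a + sin t *\<^sub>R b"

text \<open>Rotation by the angle \<open>s\<close> in the plane of \<open>a\<close> and
  \<open>b\<close>, extended by the identity on the orthogonal complement. The map adds to
  \<open>x\<close> only the change in its two plane coordinates.\<close>

lemma plane_rotation_exists:
  fixes a b :: "'a::real_inner"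
  assumes "a \<bullet> a = 1" "b \<bullet> b = 1" "a \<bullet> b = 0"
  obtains R where "orthogonal_transformation R"
    and "\<And>t. R (plane_point a b t) = plane_point a b (s + t)"
proof
  define R where "R x = x + ((cos s - 1) * (x \<bullet> a) - sin s * (x \<bullet> b)) *\<^sub>R a
      + (sin s * (x \<bullet> a) + (cos s - 1) * (x \<bullet> b)) *\<^sub>R b" for x
  have lin: "linear R"
    by (rule linearI) (simp_all add: R_def inner_add_left algebra_simps)
  have "R x \<bullet> R y = x \<bullet> y" for x y
  proof -
    define xa xb ya yb where defs: "xa = x \<bullet> a" "xb = x \<bullet> b" "ya = y \<bullet> a" "yb = y \<bullet> b"
    have "a \<bullet> y = ya" "b \<bullet> y = yb" "b \<bullet> a = 0"
      using assms by (simp_all add: defs inner_commute)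
    then have "R x \<bullet> R y = x \<bullet> y
        + ((cos s - 1) * ya - sin s * yb) * xa + (sin s * ya + (cos s - 1) * yb) * xb
        + ((cos s - 1) * xa - sin s * xb) * ya + (sin s * xa + (cos s - 1) * xb) * yb
        + ((cos s - 1) * xa - sin s * xb) * ((cos s - 1) * ya - sin s * yb)
        + (sin s * xa + (cos s - 1) * xb) * (sin s * ya + (cos s - 1) * yb)"
      using assms by (simp add: R_def inner_add_left inner_add_right defs[symmetric] algebra_simps)
    also have "\<dots> = x \<bullet> y + ((sin s)\<^sup>2 + (cos s)\<^sup>2 - 1) * (xa * ya + xb * yb)"
      by algebra
    finally show ?thesis by simp
  qed
  with lin show "orthogonal_transformation R" by (simp add: orthogonal_transformation_def)
  show "R (plane_point a b t) = plane_point a b (s + t)" for t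
    using assms
    by (simp add: R_def plane_point_def inner_add_left inner_commute cos_add sin_add algebra_simps)
qed

text \<open>By rotation invariance the measure depends only on the angle. It is additive in the
  angle, hence linear, and at angle \<open>pi\<close> the wedge is the whole ball up to a
  hyperplane, which fixes the constant.\<close>

lemma measure_wedge_plane:
  fixes a b :: "real^'n::{finite,wellorder}"
  assumes ab: "a \<bullet> a = 1" "b \<bullet> b = 1" "a \<bullet> b = 0" and t: "0 \<le> t" "t \<le> pi"
  shows "measure lebesgue (wedge (plane_point a b 0) (plane_point a b t))
    = t / pi * measure lebesgue (ball (0::real^'n::_) 1)"
proof -
  define c where "c = plane_point a b"
  define H where "H t = measure lebesgue (wedge (c 0) (c t))" for t
  have "c 0 \<noteq> 0" using ab by (auto simp: c_def plane_point_def)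
  then have null: "negligible {g. c 0 \<bullet> g = 0}" by (simp add: negligible_hyperplane)
  have rot: "measure lebesgue (wedge (c s) (c (s + t))) = H t" for s t
  proof -
    obtain R where "orthogonal_transformation R" "\<And>t. R (c t) = c (s + t)"
      using plane_rotation_exists[OF ab] unfolding c_def by metis
    then show ?thesis
      using measure_wedge_orthogonal[of R "c 0" "c t"] by (simp add: H_def)
  qed
  \<comment> \<open>Off the hyperplane normal to \<open>c 0\<close>, the condition
    \<open>0 < g \<bullet> c r\<close> changes at most once as \<open>r\<close> runs from 0 to
    \<open>s + t\<close>, so the large wedge is the disjoint union of the two small ones.\<close>
  have sep: "(g \<in> wedge (c 0) (c (s + t))) = (g \<in> wedge (c 0) (c s) \<union> wedge (c s) (c (s + t)))
      \<and> \<not> (g \<in> wedge (c 0) (c s) \<and> g \<in> wedge (c s) (c (s + t)))"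
    if st: "0 \<le> s" "0 \<le> t" "s + t \<le> pi" and g: "g \<bullet> c 0 \<noteq> 0" for s t g
  proof (cases "s + t = pi")
    case True
    then have "g \<bullet> c (s + t) = - (g \<bullet> c 0)" by (simp add: c_def plane_point_def)
    with g show ?thesis by (auto simp: wedge_def)
  next
    case False
    have pos: "0 < g \<bullet> c s \<longleftrightarrow> 0 < g \<bullet> c 0"
      if same: "0 < g \<bullet> c 0 \<longleftrightarrow> 0 < g \<bullet> c (s + t)"
    proof (cases "s + t = 0")
      case True
      then show ?thesis using st by (simp add: add_nonneg_eq_0_iff)
    next
      case ne: False
      have st': "0 < sin (s + t)" using st ne False by (intro sin_gt_zero) auto
      have s0: "0 \<le> sin s" "0 \<le> sin t" using st by (auto intro: sin_ge_zero)
      \<comment> \<open>For \<open>s + t < pi\<close> the middle vector is a nonnegative combination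
        of the outer two, so it lies on their side whenever those two agree.\<close>
      have key: "sin (s + t) * (g \<bullet> c s) = sin t * (g \<bullet> c 0) + sin s * (g \<bullet> c (s + t))"
      proof -
        have "sin (s + t) *\<^sub>R c s = sin t *\<^sub>R c 0 + sin s *\<^sub>R c (s + t)"
        proof -
          have "sin t + sin s * cos (s + t) = sin (s + t) * cos s"
          proof -
            have "sin (s + t) * cos s - sin s * cos (s + t) = sin (s + t - s)"
              by (subst sin_diff) simp
            then show ?thesis by simp
          qed
          then show ?thesis
            by (simp add: c_def plane_point_def scaleR_add_right scaleR_add_left[symmetric] mult.commute
                flip: add.assoc)
        qed
        then have "g \<bullet> (sin (s + t) *\<^sub>R c s) = g \<bullet> (sin t *\<^sub>R c 0 + sin s *\<^sub>R c (s + t))" by simp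
        then show ?thesis by (simp add: inner_add_right)
      qed
      show ?thesis
      proof (cases "0 < g \<bullet> c 0")
        case True
        have "sin s \<noteq> 0 \<or> sin t \<noteq> 0" using st' by (auto simp: sin_add)
        with s0 have "0 < sin s \<or> 0 < sin t" by auto
        then have "0 < sin t * (g \<bullet> c 0) + sin s * (g \<bullet> c (s + t))"
          using True same s0 by (auto intro: add_pos_nonneg add_nonneg_pos)
        with key st' True show ?thesis by (metis zero_less_mult_pos)
      next
        case nle: False
        then have "sin t * (g \<bullet> c 0) + sin s * (g \<bullet> c (s + t)) \<le> 0"
          using same s0 by (intro add_nonpos_nonpos mult_nonneg_nonpos) auto
        with key st' nle show ?thesis by (smt (verit) mult_pos_pos)
      qed
    qed
    then show ?thesis by (auto simp: wedge_def)
  qed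
  have add: "H (s + t) = H s + H t" if st: "0 \<le> s" "0 \<le> t" "s + t \<le> pi" for s t
  proof -
    let ?A = "wedge (c 0) (c s)" and ?B = "wedge (c s) (c (s + t))"
    have "H (s + t) = measure lebesgue (?A \<union> ?B)"
      unfolding H_def
    proof (rule measure_negligible_symdiff)
      show "?A \<union> ?B \<in> lmeasurable" by (simp add: wedge_lmeasurable fmeasurable.Un)
      show "negligible (?A \<union> ?B - wedge (c 0) (c (s + t)) \<union> (wedge (c 0) (c (s + t)) - (?A \<union> ?B)))"
        by (rule negligible_subset[OF null]) (use sep[OF st] in \<open>auto simp: inner_commute\<close>)
    qed
    also have "\<dots> = measure lebesgue ?A + measure lebesgue ?B - measure lebesgue (?A \<inter> ?B)"
      by (simp add: measure_Un3 wedge_lmeasurable)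
    also have "measure lebesgue (?A \<inter> ?B) = 0"
      by (rule negligible_imp_measure0, rule negligible_subset[OF null])
        (use sep[OF st] in \<open>auto simp: inner_commute\<close>)
    finally show ?thesis using rot by (simp add: H_def)
  qed
  have "H pi = measure lebesgue (ball (0::real^'n::_) 1)"
    unfolding H_def
  proof (rule measure_negligible_symdiff)
    have "c pi = - c 0" by (simp add: c_def plane_point_def)
    then show "negligible (ball 0 1 - wedge (c 0) (c pi) \<union> (wedge (c 0) (c pi) - ball 0 1))"
      by (intro negligible_subset[OF null]) (auto simp: wedge_def inner_commute)
  qed simp
  moreover have "H t = t / pi * H pi"
    by (rule additive_nonneg_linear) (use add t in \<open>auto simp: H_def\<close>)
  ultimately show ?thesis by (simp add: H_def c_def)
qed

text \<open>Gram-Schmidt: the normalized component of \<open>v\<close> orthogonal to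
  \<open>u\<close> spans with \<open>u\<close> a plane in which \<open>v\<close> sits at angle
  \<open>arccos (u \<bullet> v)\<close>. If that component vanishes, \<open>v\<close> is
  \<open>u\<close> or \<open>- u\<close> and the wedge is empty or almost the whole ball.\<close>

lemma measure_wedge:
  fixes u v :: "real^'n::{finite,wellorder}"
  assumes u: "norm u = 1" and v: "norm v = 1"
  shows "measure lebesgue (wedge u v) = arccos (u \<bullet> v) / pi * measure lebesgue (ball (0::real^'n::_) 1)"
proof -
  have uu: "u \<bullet> u = 1" "v \<bullet> v = 1" using u v by (simp_all add: norm_eq_1)
  have bound: "\<bar>u \<bullet> v\<bar> \<le> 1" using Cauchy_Schwarz_ineq2[of u v] u v by simp
  then have b: "- 1 \<le> u \<bullet> v" "u \<bullet> v \<le> 1" by auto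
  define t where "t = arccos (u \<bullet> v)"
  have t: "cos t = u \<bullet> v" "0 \<le> t" "t \<le> pi"
    using b by (auto simp: t_def arccos_lbound arccos_ubound)
  define r where "r = v - (u \<bullet> v) *\<^sub>R u"
  have "r \<bullet> r = 1 - (u \<bullet> v)\<^sup>2"
    by (simp add: r_def inner_diff_left inner_diff_right uu inner_commute power2_eq_square)
  then have rr: "r \<bullet> r = (sin t)\<^sup>2" by (simp add: sin_squared_eq t)
  have ur: "u \<bullet> r = 0" by (simp add: r_def inner_diff_right uu)
  show ?thesis
  proof (cases "sin t = 0")
    case False
    define b where "b = (1 / sin t) *\<^sub>R r"
    have "b \<bullet> b = 1" using False rr by (simp add: b_def power2_eq_square field_simps)
    moreover have "u \<bullet> b = 0" using ur by (simp add: b_def)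
    moreover have "plane_point u b 0 = u" by (simp add: plane_point_def)
    moreover have "plane_point u b t = v"
      using False by (simp add: plane_point_def b_def t r_def)
    ultimately show ?thesis
      using measure_wedge_plane[OF uu(1), of b t] t by (simp add: t_def)
  next
    case True
    then have v: "v = (u \<bullet> v) *\<^sub>R u" using rr by (simp add: r_def)
    consider "t = 0" | "t = pi" 
      using True t by (metis less_eq_real_def order_less_irrefl sin_gt_zero)
    then show ?thesis
    proof cases
      case 1
      then have "v = u" using v t by simp
      then show ?thesis using 1 by (simp add: t_def wedge_def)
    next
      case 2
      then have vu: "v = - u" using v t by (metis cos_pi scaleR_minus1_left)
      have "u \<noteq> 0" using u by auto
      then have null: "negligible {g. u \<bullet> g = 0}" by (simp add: negligible_hyperplane)
      have "measure lebesgue (wedge u v) = measure lebesgue (ball (0::real^'n::_) 1)"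
      proof (rule measure_negligible_symdiff)
        show "negligible (ball 0 1 - wedge u v \<union> (wedge u v - ball 0 1))"
          by (rule negligible_subset[OF null]) (auto simp: vu wedge_def inner_commute)
      qed simp
      then show ?thesis using 2 by (simp add: t_def)
    qed
  qed
qed

text \<open>A uniform point \<open>g\<close> of the ball induces the cut
  \<open>{i. 0 < g \<bullet> u i}\<close>, and \<open>p U\<close> is the probability of obtaining
  \<open>U\<close>. The cells of the cuts that separate \<open>i\<close> from \<open>j\<close>
  together form the wedge of \<open>u i\<close> and \<open>u j\<close>.\<close>

lemma cut_distribution_exists:
  fixes u :: "'v::finite \<Rightarrow> real^'n::{finite,wellorder}"
  assumes u: "\<And>i. norm (u i) = 1"
  obtains p :: "'v set \<Rightarrow> real" where "\<And>U. 0 \<le> p U" and "(\<Sum>U\<in>UNIV. p U) = 1"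
    and "\<And>i j. (\<Sum>U | (i \<in> U) \<noteq> (j \<in> U). p U) = arccos (u i \<bullet> u j) / pi"
proof -
  define B where "B = ball (0::real^'n::_) 1"
  define A where "A i = {g \<in> B. 0 < g \<bullet> u i}" for i
  define cell where "cell U = {g \<in> B. {i. 0 < g \<bullet> u i} = U}" for U
  define m where "m = measure lebesgue B"
  have "0 < m" by (simp add: m_def B_def content_ball_pos)
  have B: "B \<in> lmeasurable" by (simp add: B_def)
  have A: "A i \<in> lmeasurable" for i
    unfolding A_def B_def by (rule ball_halfspace_lmeasurable)
  have cell: "cell U \<in> lmeasurable" for U
  proof -
    have "cell U = (\<Inter>i. if i \<in> U then A i else B - A i)"
    proof -
      have "g \<in> cell U \<longleftrightarrow> g \<in> B \<and> (\<forall>i. (0 < g \<bullet> u i) = (i \<in> U))" for g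
        by (auto simp: cell_def)
      moreover have "g \<in> (if i \<in> U then A i else B - A i) \<longleftrightarrow> g \<in> B \<and> (0 < g \<bullet> u i) = (i \<in> U)" for g i
        by (auto simp: A_def)
      ultimately show ?thesis by blast
    qed
    also have "\<dots> \<in> sets lebesgue"
      using A B by (intro sets.finite_INT) (auto simp: fmeasurableD intro!: sets.Diff)
    finally show ?thesis by (rule fmeasurableI2[OF B, rotated]) (auto simp: cell_def)
  qed
  have sum: "measure lebesgue (\<Union>U\<in>X. cell U) = (\<Sum>U\<in>X. measure lebesgue (cell U))" for X
    by (rule measure_UNION') (use cell in \<open>auto simp: cell_def pairwise_def disjnt_def\<close>)
  have union: "(\<Union>U\<in>X. cell U) = {g \<in> B. {i. 0 < g \<bullet> u i} \<in> X}" for X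
    by (auto simp: cell_def)
  show thesis
  proof
    show "0 \<le> measure lebesgue (cell U) / m" for U using \<open>0 < m\<close> by simp
    have "(\<Union>U. cell U) = B" by (simp add: union)
    then show "(\<Sum>U\<in>UNIV. measure lebesgue (cell U) / m) = 1"
      using sum[of UNIV] \<open>0 < m\<close> by (simp add: m_def flip: sum_divide_distrib)
    show "(\<Sum>U | (i \<in> U) \<noteq> (j \<in> U). measure lebesgue (cell U) / m) = arccos (u i \<bullet> u j) / pi" for i j
    proof -
      have "(\<Union>U\<in>{U. (i \<in> U) \<noteq> (j \<in> U)}. cell U) = wedge (u i) (u j)"
        by (simp add: union wedge_def B_def)
      then have "(\<Sum>U | (i \<in> U) \<noteq> (j \<in> U). measure lebesgue (cell U)) = arccos (u i \<bullet> u j) / pi * m"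
        using sum[of "{U. (i \<in> U) \<noteq> (j \<in> U)}"] measure_wedge[OF u u, of i j]
        by (simp add: m_def B_def)
      then show ?thesis using \<open>0 < m\<close> by (simp flip: sum_divide_distrib)
    qed
  qed
qed

subsection \<open>Positive semidefinite matrices\<close>

lemma quadratic_form_eq: "x \<bullet> (A *v x) = (\<Sum>i\<in>UNIV. \<Sum>j\<in>UNIV. A $ i $ j * x $ i * x $ j)"
  for A :: "real^'n::finite^'n"
  by (simp add: inner_vec_def matrix_vector_mult_def sum_distrib_left algebra_simps)

lemma psd_iff: "psd A \<longleftrightarrow> (\<forall>i j. A $ i $ j = A $ j $ i)
    \<and> (\<forall>x::real^'v::finite. 0 \<le> (\<Sum>i\<in>UNIV. \<Sum>j\<in>UNIV. A $ i $ j * x $ i * x $ j))"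
  by (auto simp: psd_def quadratic_form_eq vec_eq_iff transpose_def)

lemma psd_sym: "psd A \<Longrightarrow> A $ i $ j = A $ j $ i"
  by (simp add: psd_iff)

lemma psd_zero: "psd 0"
  by (simp add: psd_iff)

lemma psd_add: "psd A \<Longrightarrow> psd B \<Longrightarrow> psd (A + B)"
  by (simp add: psd_iff distrib_right sum.distrib)

lemma psd_scaleR: "psd A \<Longrightarrow> 0 \<le> c \<Longrightarrow> psd (c *\<^sub>R A)"
  by (auto simp: psd_iff mult.assoc simp flip: sum_distrib_left)

lemma psd_outer: "psd (outer u u)"
proof -
  have "(\<Sum>i\<in>UNIV. \<Sum>j\<in>UNIV. u $ i * u $ j * x $ i * x $ j) = (u \<bullet> x)\<^sup>2" for x
    by (simp add: inner_vec_def power2_eq_square sum_product algebra_simps)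
  then show ?thesis by (simp add: psd_iff outer_def mult.commute)
qed

lemma form_axis_add:
  fixes A :: "real^'n::finite^'n"
  assumes "\<And>i j. A $ i $ j = A $ j $ i"
  shows "(x + t *\<^sub>R axis k 1) \<bullet> (A *v (x + t *\<^sub>R axis k 1))
    = x \<bullet> (A *v x) + 2 * t * (A $ k \<bullet> x) + t\<^sup>2 * A $ k $ k"
proof -
  have 1: "A *v axis k 1 = A $ k"
    using assms by (simp add: vec_eq_iff matrix_vector_mult_basis column_def)
  have 2: "axis k 1 \<bullet> (A *v x) = A $ k \<bullet> x"
    by (simp add: inner_axis' matrix_vector_mul_component)
  have 3: "axis k 1 \<bullet> A $ k = A $ k $ k" by (simp add: inner_axis')
  show ?thesis
    by (simp add: matrix_vector_right_distrib matrix_vector_mult_scaleR inner_add_left inner_add_right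
        1 2 3 power2_eq_square inner_commute[of x] algebra_simps)
qed

lemma psd_diag_nonneg: assumes "psd A" shows "0 \<le> A $ i $ i"
proof -
  have "0 \<le> axis i 1 \<bullet> (A *v axis i 1)" using assms by (simp add: psd_def)
  then show ?thesis by (simp add: inner_axis' matrix_vector_mult_basis column_def)
qed

text \<open>The form is nonnegative at the sum and at the difference of two basis vectors
  (\<open>t\<close> equal to 1 and -1).\<close>

lemma psd_entry_bound:
  assumes "psd A" shows "\<bar>A $ i $ j\<bar> \<le> (A $ i $ i + A $ j $ j) / 2"
proof -
  have "0 \<le> A $ i $ i + 2 * t * A $ i $ j + t\<^sup>2 * A $ j $ j" for t
  proof -
    have "0 \<le> (axis i 1 + t *\<^sub>R axis j 1) \<bullet> (A *v (axis i 1 + t *\<^sub>R axis j 1))"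
      using assms by (simp add: psd_def)
    also have "\<dots> = A $ i $ i + 2 * t * A $ j $ i + t\<^sup>2 * A $ j $ j"
      using psd_sym[OF assms]
      by (subst form_axis_add) (auto simp: inner_axis inner_axis' matrix_vector_mult_basis column_def)
    finally show ?thesis using psd_sym[OF assms, of i j] by simp
  qed
  from this[of 1] this[of "-1"] show ?thesis by simp
qed

text \<open>Symmetric Gaussian elimination, one index at a time; an index whose diagonal entry vanishes
  contributes the zero vector, since \<open>x / 0 = 0\<close>.\<close>

lemma psd_sum_outer:
  assumes "psd A" "\<And>i. i \<notin> N \<Longrightarrow> A $ i $ i = 0"
  shows "\<exists>v. A = (\<Sum>k\<in>N. outer (v k) (v k))"
proof -
  have "finite N" by simp
  then show ?thesis using assms
  proof (induction N arbitrary: A)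
    case empty
    then have "A $ i $ j = 0" for i j using psd_entry_bound[of A i j] by simp
    then show ?case by (simp add: vec_eq_iff)
  next
    case (insert k N)
    define v where "v = (1 / sqrt (A $ k $ k)) *\<^sub>R A $ k"
    define A' where "A' = A - outer v v"
    have sym: "A $ i $ j = A $ j $ i" for i j using insert.prems psd_sym by blast
    have Akk: "0 \<le> A $ k $ k" using insert.prems psd_diag_nonneg by blast
    have vv: "v $ i * v $ j = A $ k $ i * A $ k $ j / A $ k $ k" for i j
      using Akk by (simp add: v_def)
    have form: "x \<bullet> (A' *v x) = x \<bullet> (A *v x) - (A $ k \<bullet> x)\<^sup>2 / A $ k $ k" for x
    proof -
      have "outer v v *v x = (v \<bullet> x) *\<^sub>R v"
        by (simp add: vec_eq_iff outer_def matrix_vector_mult_def inner_vec_def sum_distrib_left algebra_simps)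
      then have "x \<bullet> (A' *v x) = x \<bullet> (A *v x) - (v \<bullet> x)\<^sup>2"
        by (simp add: A'_def matrix_vector_mult_diff_rdistrib inner_diff_right power2_eq_square inner_commute)
      also have "(v \<bullet> x)\<^sup>2 = (A $ k \<bullet> x)\<^sup>2 / A $ k $ k"
        using Akk by (simp add: v_def power_divide)
      finally show ?thesis .
    qed
    have "0 \<le> x \<bullet> (A' *v x)" for x
    proof (cases "A $ k $ k = 0")
      case True
      then show ?thesis using insert.prems form by (simp add: psd_def)
    next
      case False
      \<comment> \<open>The minimizer of the form of \<open>A\<close> along direction
        \<open>k\<close> through \<open>x\<close>; the minimum is the form of the Schur complement
        \<open>A'\<close> at \<open>x\<close>.\<close>
      define t where "t = - (A $ k \<bullet> x) / A $ k $ k"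
      have "0 \<le> (x + t *\<^sub>R axis k 1) \<bullet> (A *v (x + t *\<^sub>R axis k 1))"
        using insert.prems by (simp add: psd_def)
      also have "\<dots> = x \<bullet> (A' *v x)"
        unfolding form_axis_add[OF sym] form t_def using False
        by (simp add: power2_eq_square field_simps)
      finally show ?thesis .
    qed
    then have psd': "psd A'"
      using insert.prems
      by (auto simp: psd_def A'_def transpose_def vec_eq_iff outer_def mult.commute sym)
    have "A' $ i $ i = 0" if "i \<notin> N" for i
    proof (cases "i = k")
      case True
      then show ?thesis by (simp add: A'_def outer_def vv)
    next
      case False
      \<comment> \<open>The new diagonal entry is minus a square, yet nonnegative because
        \<open>A'\<close> is positive semidefinite.\<close>
      then have "A $ i $ i = 0" using insert.prems that by simp
      moreover have "0 \<le> v $ i * v $ i" by simp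
      ultimately show ?thesis using psd_diag_nonneg[OF psd', of i]
        by (auto simp: A'_def outer_def mult_le_0_iff)
    qed
    then obtain w where w: "A' = (\<Sum>k\<in>N. outer (w k) (w k))" using insert.IH[OF psd'] by blast
    have "(\<Sum>l\<in>N. outer ((w(k := v)) l) ((w(k := v)) l)) = A'"
      unfolding w using insert.hyps by (intro sum.cong) auto
    moreover have "A = outer v v + A'" by (simp add: A'_def)
    ultimately have "A = (\<Sum>l\<in>insert k N. outer ((w(k := v)) l) ((w(k := v)) l))"
      unfolding sum.insert[OF insert.hyps(1,2)] by simp
    then show ?case by (rule exI[of _ "w(k := v)"])
  qed
qed

text \<open>The index type \<open>'v bit0\<close> (of size twice that of \<open>'v\<close>) is chosen because the library
  proves the rotation invariance of Lebesgue measure only for well-ordered index types.\<close>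

lemma psd_gram:
  fixes A :: "real^'v^'v::finite"
  assumes "psd A"
  obtains u :: "'v \<Rightarrow> real^('v bit0)" where "\<And>i j. A $ i $ j = u i \<bullet> u j"
proof -
  obtain v :: "'v \<Rightarrow> real^'v" where v: "A = (\<Sum>k\<in>UNIV. outer (v k) (v k))" using psd_sum_outer[OF assms, of UNIV] by blast
  have "card (UNIV :: 'v set) \<le> card (UNIV :: 'v bit0 set)" by simp
  then obtain f :: "'v \<Rightarrow> 'v bit0" where f: "inj f"
    using card_le_inj[of "UNIV :: 'v set" "UNIV :: 'v bit0 set"] by auto
  \<comment> \<open>Coordinate \<open>f k\<close> of \<open>u i\<close> is entry \<open>i\<close> of
    \<open>v k\<close>; the remaining coordinates are padded with 0.\<close>
  define u :: "'v \<Rightarrow> real^('v bit0)" where "u i = (\<chi> l. if l \<in> range f then v (inv f l) $ i else 0)" for i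
  have "u i \<bullet> u j = (\<Sum>l\<in>range f. v (inv f l) $ i * v (inv f l) $ j)" for i j
    unfolding inner_vec_def by (rule sum.mono_neutral_cong_right) (auto simp: u_def)
  also have "(\<Sum>l\<in>range f. v (inv f l) $ i * v (inv f l) $ j) = A $ i $ j" for i j
    using f by (simp add: sum.reindex v outer_def)
  finally show thesis using that by metis
qed

subsection \<open>The approximation constant\<close>

text \<open>\<open>LEAST\<close> in \<open>alpha_GW\<close> is meaningful only if the minimum over
  the half-open interval is attained. Compactness gives a minimum on \<open>{1..pi}\<close>, and
  smaller angles give values above 1, the value at \<open>pi\<close>.\<close>

lemma alpha_GW_attained:
  obtains \<theta> where "0 < \<theta>" "\<theta> \<le> pi" "alpha_GW = (2 / pi) * (\<theta> / (1 - cos \<theta>))"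
    and "\<And>\<phi>. 0 < \<phi> \<Longrightarrow> \<phi> \<le> pi \<Longrightarrow> alpha_GW \<le> (2 / pi) * (\<phi> / (1 - cos \<phi>))"
proof -
  define f where "f t = (2 / pi) * (t / (1 - cos t))" for t
  have pos: "0 < 1 - cos t" if "0 < t" "t \<le> pi" for t
    using cos_monotone_0_pi[of 0 t] that by simp
  have pi4: "pi < 4" and pi1: "1 < pi" using pi_less_4 pi_gt3 by auto
  have "\<forall>t\<in>{1..pi}. 1 - cos t \<noteq> 0"
  proof
    fix t assume "t \<in> {1..pi}"
    then show "1 - cos t \<noteq> 0" using pos[of t] by auto
  qed
  then have "continuous_on {1..pi} f"
    unfolding f_def
    by (intro continuous_on_mult continuous_on_divide continuous_on_diff continuous_on_cos
        continuous_on_const continuous_on_id)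
  then obtain \<theta> where \<theta>: "\<theta> \<in> {1..pi}" and min: "\<And>t. t \<in> {1..pi} \<Longrightarrow> f \<theta> \<le> f t"
    using continuous_attains_inf[of "{1..pi}" f] pi1 by auto
  have least: "f \<theta> \<le> f t" if t: "0 < t" "t \<le> pi" for t
  proof (cases "1 \<le> t")
    case True
    then show ?thesis using min t by simp
  next
    case False
    \<comment> \<open>Here \<open>1 - cos t\<close> is twice the square of
      \<open>sin (t / 2)\<close>, which bounds it by \<open>t / 2\<close> for \<open>t < 1\<close>,
      so \<open>f t\<close> is at least \<open>4 / pi\<close>.\<close>
    have "sin (t / 2) ^ 2 \<le> (t / 2)\<^sup>2"
      by (rule abs_le_square_iff[THEN iffD1, OF abs_sin_x_le_abs_x])
    then have "1 - cos t \<le> t\<^sup>2 / 2"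
      using cos_double_sin[of "t / 2"] by (simp add: power2_eq_square)
    also have "\<dots> \<le> t / 2" using False t by (simp add: power2_eq_square mult_left_le)
    finally have "2 \<le> t / (1 - cos t)" using pos[OF t] by (simp add: field_simps)
    then have "4 / pi \<le> f t"
      unfolding f_def using mult_left_mono[of 2 "t / (1 - cos t)" "2 / pi"] by simp
    moreover have "1 < 4 / pi" using pi4 by simp
    moreover have "f \<theta> \<le> f pi" using min[of pi] pi1 by simp
    moreover have "f pi = 1" by (simp add: f_def)
    ultimately show ?thesis by linarith
  qed
  have "alpha_GW = f \<theta>"
    unfolding alpha_GW_def by (rule Least_equality) (use \<theta> least in \<open>auto simp: f_def intro!: exI[of _ \<theta>]\<close>)
  then show thesis using that[of \<theta>] \<theta> least by (simp add: f_def)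
qed

lemma alpha_GW_bounds: "0 < alpha_GW" "alpha_GW \<le> 1"
proof -
  obtain \<theta> where \<theta>: "0 < \<theta>" "\<theta> \<le> pi" "alpha_GW = (2 / pi) * (\<theta> / (1 - cos \<theta>))"
    and le: "\<And>\<phi>. 0 < \<phi> \<Longrightarrow> \<phi> \<le> pi \<Longrightarrow> alpha_GW \<le> (2 / pi) * (\<phi> / (1 - cos \<phi>))"
    by (rule alpha_GW_attained) blast
  have "cos \<theta> < 1" using cos_monotone_0_pi[of 0 \<theta>] \<theta> by simp
  then show "0 < alpha_GW" unfolding \<theta>(3) using \<theta> by (intro mult_pos_pos divide_pos_pos) auto
  show "alpha_GW \<le> 1" using le[of pi] by simp
qed

text \<open>Minimality of \<open>alpha_GW\<close> evaluated at the angle \<open>arccos c\<close>.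
  The case \<open>c = 1\<close> is the angle 0, outside the range of the minimum; there both sides
  vanish.\<close>

lemma alpha_GW_arccos:
  assumes "\<bar>c\<bar> \<le> 1"
  shows "alpha_GW * ((1 - c) / 2) \<le> arccos c / pi"
proof (cases "c = 1")
  case False
  define t where "t = arccos c"
  have t: "cos t = c" "0 \<le> t" "t \<le> pi"
    using assms by (auto simp: t_def abs_le_iff arccos_lbound arccos_ubound)
  then have "0 < t" using False by (cases "t = 0") auto
  then have "alpha_GW \<le> (2 / pi) * (t / (1 - c))"
    using alpha_GW_attained t by metis
  moreover have "0 < 1 - c" using False assms by auto
  ultimately have "alpha_GW * (1 - c) \<le> 2 / pi * t" by (simp add: field_simps)
  then show ?thesis by (simp add: t_def field_simps)
qed simp

subsection \<open>Semidefinite duality\<close>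

text \<open>The adjoint Laplacian indexed by edges as sets, so that it can be paired with weights;
  both orderings of an edge contribute the same value, hence the halving.\<close>

definition edge_val :: "real^'v^'v::finite \<Rightarrow> 'v set \<Rightarrow> real" where
  "edge_val Y e = (\<Sum>(i, j) | {i, j} = e. laplacian_adj Y i j) / 2"

lemma edge_val_doubleton:
  assumes "i \<noteq> j" shows "edge_val Y {i, j} = laplacian_adj Y i j"
proof -
  have "{(k, l). {k, l} = {i, j}} = {(i, j), (j, i)}" by (auto simp: doubleton_eq_iff)
  then show ?thesis using assms by (simp add: edge_val_def laplacian_adj_def)
qed

lemma edge_val_zero: "edge_val 0 e = 0"
  by (simp add: edge_val_def laplacian_adj_def split_def)

lemma edge_val_add: "edge_val (X + Y) e = edge_val X e + edge_val Y e"
  by (simp add: edge_val_def laplacian_adj_def split_def sum.distrib sum_subtractf add_divide_distrib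
      diff_divide_distrib)

lemma edge_val_scaleR: "edge_val (c *\<^sub>R Y) e = c * edge_val Y e"
  by (simp add: edge_val_def laplacian_adj_def split_def sum_distrib_left right_diff_distrib distrib_left)

lemma edge_val_nonneg:
  assumes "psd Y" shows "0 \<le> edge_val Y e"
proof -
  have "0 \<le> laplacian_adj Y i j" for i j
    using psd_entry_bound[OF assms, of i j] psd_sym[OF assms, of i j]
    by (simp add: laplacian_adj_def)
  then show ?thesis unfolding edge_val_def by (intro divide_nonneg_nonneg sum_nonneg) auto
qed

lemma simple_graph_edgeE:
  assumes "simple_graph E" "e \<in> E"
  obtains i j where "e = {i, j}" "i \<noteq> j"
  using assms by (auto simp: simple_graph_def card_2_iff)

lemma edge_constraint_iff:
  assumes "simple_graph E"
  shows "(\<forall>i j. {i, j} \<in> E \<longrightarrow> z {i, j} \<le> (1/4) * laplacian_adj Y i j)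
    \<longleftrightarrow> (\<forall>e\<in>E. z e \<le> edge_val Y e / 4)"
proof -
  have "i \<noteq> j" if "{i, j} \<in> E" for i j
    using assms that by (auto simp: simple_graph_def)
  then have val: "edge_val Y {i, j} = laplacian_adj Y i j" if "{i, j} \<in> E" for i j
    using that by (simp add: edge_val_doubleton)
  show ?thesis
  proof (intro iffI allI ballI impI)
    fix e assume *: "\<forall>i j. {i, j} \<in> E \<longrightarrow> z {i, j} \<le> (1/4) * laplacian_adj Y i j" and "e \<in> E"
    then obtain i j where "e = {i, j}" using simple_graph_edgeE[OF assms] by metis
    with * \<open>e \<in> E\<close> show "z e \<le> edge_val Y e / 4" by (simp add: val)
  next
    fix i j assume *: "\<forall>e\<in>E. z e \<le> edge_val Y e / 4" and "{i, j} \<in> E"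
    then have "z {i, j} \<le> edge_val Y {i, j} / 4" by blast
    then show "z {i, j} \<le> (1/4) * laplacian_adj Y i j" by (simp add: val[OF \<open>{i, j} \<in> E\<close>])
  qed
qed

section \<open>The trace inner product and the Laplacian\<close>

lemma mat_inner_eq: "mat_inner A B = (\<Sum>i\<in>UNIV. \<Sum>j\<in>UNIV. A $ i $ j * B $ i $ j)"
  unfolding mat_inner_def trace_def matrix_matrix_mult_def transpose_def
  by (simp, rule sum.swap)

lemma mat_inner_scaleR_left: "mat_inner (c *\<^sub>R A) B = c * mat_inner A B"
  by (simp add: mat_inner_eq sum_distrib_left mult.assoc)

lemma mat_inner_sum_left: "mat_inner (\<Sum>k\<in>K. A k) B = (\<Sum>k\<in>K. mat_inner (A k) B)"
proof -
  have "mat_inner (A + A') B = mat_inner A B + mat_inner A' B" for A A'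
    by (simp add: mat_inner_eq sum.distrib distrib_right)
  moreover have "mat_inner 0 B = 0" by (simp add: mat_inner_eq)
  ultimately show ?thesis
    by (induction K rule: infinite_finite_induct) simp_all
qed

lemma mat_inner_outer_left: "mat_inner (outer u u) Y = u \<bullet> (Y *v u)"
  by (simp add: mat_inner_eq outer_def quadratic_form_eq algebra_simps)

lemma mat_inner_outer_right: "mat_inner A (outer u u) = u \<bullet> (A *v u)"
  by (simp add: mat_inner_eq outer_def quadratic_form_eq algebra_simps)

text \<open>Adjointness of \<open>laplacian\<close> and \<open>edge_val\<close>, obtained by
  grouping ordered pairs by their edge. It reduces weak duality to a comparison edge by
  edge.\<close>

lemma mat_inner_laplacian:
  fixes E :: "'v::finite set set"
  shows "mat_inner ((1/4) *\<^sub>R laplacian E w) Y = (\<Sum>e\<in>E. w e * (edge_val Y e / 4))"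
proof -
  have edge: "mat_inner (outer (axis i 1 - axis j 1) (axis i 1 - axis j 1)) Y = laplacian_adj Y i j" for i j
    by (simp add: mat_inner_outer_left laplacian_adj_def matrix_vector_mult_diff_distrib
        inner_diff_left inner_diff_right inner_axis' matrix_vector_mult_basis column_def)
  define h :: "'v \<times> 'v \<Rightarrow> 'v set" where "h p = {fst p, snd p}" for p
  define g where "g p = w (h p) * laplacian_adj Y (fst p) (snd p)" for p
  have "mat_inner (laplacian E w) Y = (\<Sum>p | h p \<in> E. g p) / 2"
    by (simp add: laplacian_def mat_inner_scaleR_left mat_inner_sum_left split_def edge h_def g_def)
  also have "(\<Sum>p | h p \<in> E. g p) = (\<Sum>e\<in>E. \<Sum>p | p \<in> {p. h p \<in> E} \<and> h p = e. g p)"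
    by (rule sum.group[symmetric]) auto
  also have "\<dots> = (\<Sum>e\<in>E. w e * (\<Sum>p | h p = e. laplacian_adj Y (fst p) (snd p)))"
    unfolding sum_distrib_left by (intro sum.cong refl) (auto simp: g_def)
  also have "\<dots> / 2 = (\<Sum>e\<in>E. w e * edge_val Y e)"
    by (subst sum_divide_distrib) (simp add: edge_val_def split_def h_def)
  finally show ?thesis
    by (simp add: mat_inner_scaleR_left sum_divide_distrib)
qed

lemma laplacian_sym: "laplacian E w $ i $ j = laplacian E w $ j $ i"
  by (simp add: laplacian_def split_def outer_def mult.commute)

text \<open>Testing the hypothesis on the rank-one matrices \<open>outer v v\<close> gives the
  inequality of quadratic forms.\<close>

lemma Diag_ge_laplacian:
  assumes "\<And>Y. psd Y \<Longrightarrow> mat_inner ((1/4) *\<^sub>R laplacian E w) Y \<le> x \<bullet> diag Y"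
  shows "Diag x \<succeq> (1/4) *\<^sub>R laplacian E w"
proof -
  have "0 \<le> v \<bullet> ((Diag x - (1/4) *\<^sub>R laplacian E w) *v v)" for v
  proof -
    have "v \<bullet> (Diag x *v v) = x \<bullet> diag (outer v v)"
      by (simp add: inner_vec_def matrix_vector_mult_def Diag_def diag_def outer_def if_distrib
          if_distribR cong: if_cong) (simp add: algebra_simps)
    then show ?thesis
      using assms[OF psd_outer, of v] unfolding mat_inner_outer_right
      by (simp add: matrix_vector_mult_diff_rdistrib inner_diff_right)
  qed
  then show ?thesis
    by (auto simp: loewner_ge_def psd_def transpose_def vec_eq_iff Diag_def laplacian_sym)
qed

section \<open>Attainment and positivity of the polar value\<close>

definition polar_feasible :: "'v::finite set set \<Rightarrow> ('v set \<Rightarrow> real) \<Rightarrow> real \<Rightarrow> real^'v^'v \<Rightarrow> bool" where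
  "polar_feasible E z \<mu> Y \<longleftrightarrow> psd Y \<and> diag Y = \<mu> *\<^sub>R 1 \<and> (\<forall>e\<in>E. z e \<le> edge_val Y e / 4)"

lemma polar_feasible_nonneg: "polar_feasible E z \<mu> Y \<Longrightarrow> 0 \<le> \<mu>"
  using psd_diag_nonneg[of Y undefined] by (auto simp: polar_feasible_def diag_def vec_eq_iff)

lemma continuous_edge_val: "continuous_on UNIV (\<lambda>Y. edge_val Y e)"
  unfolding edge_val_def laplacian_adj_def split_def
  by (intro continuous_on_divide continuous_on_sum continuous_on_add continuous_on_diff
      continuous_on_component continuous_on_id continuous_on_const) simp

lemma closed_psd: "closed {Y :: real^'v^'v::finite. psd Y}"
  unfolding psd_iff
  by (intro closed_Collect_conj closed_Collect_all closed_Collect_eq closed_Collect_le continuous_on_sum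
      continuous_on_mult continuous_on_component continuous_on_id continuous_on_const)

text \<open>Compactness: below a known feasible value \<open>M\<close> the diagonal is bounded, and
  by \<open>psd_entry_bound\<close> so are all entries.\<close>

lemma polar_minimizer_exists:
  fixes E :: "'v::finite set set"
  assumes "simple_graph E" "z \<in> nonneg_vecs E"
  obtains \<mu> Y where "polar_feasible E z \<mu> Y" "\<And>\<mu>' Y'. polar_feasible E z \<mu>' Y' \<Longrightarrow> \<mu> \<le> \<mu>'"
proof -
  \<comment> \<open>An arbitrary vertex at which the common diagonal value is read off, so that the
    minimization ranges over \<open>Y\<close> alone.\<close>
  define i0 :: 'v where "i0 = undefined"
  \<comment> \<open>A quarter of the edge value of \<open>M *\<^sub>R mat 1\<close> is
    \<open>M / 2\<close>, the sum of all \<open>z e\<close>, which dominates each of them.\<close>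
  define M where "M = 2 * (\<Sum>e\<in>E. z e)"
  have z: "0 \<le> z e" if "e \<in> E" for e using assms(2) that by (auto simp: nonneg_vecs_def PiE_def Pi_def)
  have "0 \<le> M" using z by (simp add: M_def sum_nonneg)
  define T where "T = {Y :: real^'v^'v. psd Y \<and> (\<forall>i. Y $ i $ i = Y $ i0 $ i0) \<and> Y $ i0 $ i0 \<le> M
    \<and> (\<forall>e\<in>E. z e \<le> edge_val Y e / 4)}"
  have T_iff: "polar_feasible E z (Y $ i0 $ i0) Y \<and> Y $ i0 $ i0 \<le> M" if "Y \<in> T" for Y
    using that by (auto simp: T_def polar_feasible_def diag_def vec_eq_iff)
  have T_I: "Y \<in> T \<and> Y $ i0 $ i0 = \<mu>" if "polar_feasible E z \<mu> Y" "\<mu> \<le> M" for \<mu> Y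
    using that by (auto simp: T_def polar_feasible_def diag_def vec_eq_iff)
  have "closed T"
    unfolding T_def Ball_def
    by (intro closed_Collect_conj closed_psd closed_Collect_all closed_Collect_imp open_Collect_const
        closed_Collect_eq closed_Collect_le continuous_on_divide continuous_edge_val
        continuous_on_component continuous_on_id continuous_on_const) simp
  moreover have "bounded T"
  proof (rule boundedI)
    fix Y assume "Y \<in> T"
    then have Y: "psd Y" "\<And>i. Y $ i $ i \<le> M" by (auto simp: T_def) metis
    have "norm (Y $ i) \<le> (\<Sum>j\<in>(UNIV :: 'v set). M)" for i
    proof (rule order_trans[OF norm_le_l1_cart], rule sum_mono)
      show "\<bar>Y $ i $ j\<bar> \<le> M" for j
        using Y(2)[of i] Y(2)[of j] by (intro order_trans[OF psd_entry_bound[OF Y(1)]]) simp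
    qed
    then have "(\<Sum>i\<in>UNIV. norm (Y $ i)) \<le> (\<Sum>i\<in>(UNIV :: 'v set). \<Sum>j\<in>(UNIV :: 'v set). M)"
      by (intro sum_mono)
    moreover have "norm Y \<le> (\<Sum>i\<in>UNIV. norm (Y $ i))"
      unfolding norm_vec_def by (rule L2_set_le_sum) simp
    ultimately show "norm Y \<le> (\<Sum>i\<in>(UNIV :: 'v set). \<Sum>j\<in>(UNIV :: 'v set). M)" by linarith
  qed
  ultimately have "compact T" by (simp add: compact_eq_bounded_closed)
  moreover have "polar_feasible E z M (M *\<^sub>R mat 1)"
  proof -
    have "psd (mat 1 :: real^'v^'v)" by (simp add: psd_def)
    moreover have "z e \<le> edge_val (M *\<^sub>R mat 1) e / 4" if eE: "e \<in> E" for e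
    proof -
      obtain i j where e: "e = {i, j}" "i \<noteq> j" by (rule simple_graph_edgeE[OF assms(1) eE])
      have "z e \<le> (\<Sum>e\<in>E. z e)" using z eE by (intro member_le_sum) auto
      then show ?thesis using e(2) by (simp add: e(1) edge_val_doubleton laplacian_adj_def M_def mat_def)
    qed
    ultimately show ?thesis
      using \<open>0 \<le> M\<close> by (auto simp: polar_feasible_def psd_scaleR diag_def mat_def vec_eq_iff)
  qed
  then have "T \<noteq> {}" using T_I by blast
  moreover have "continuous_on T (\<lambda>Y. Y $ i0 $ i0)"
    by (intro continuous_on_component continuous_on_id)
  ultimately obtain Y where Y: "Y \<in> T" "\<And>Y'. Y' \<in> T \<Longrightarrow> Y $ i0 $ i0 \<le> Y' $ i0 $ i0"
    using continuous_attains_inf[of T "\<lambda>Y. Y $ i0 $ i0"] by blast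
  show thesis
  proof
    show "polar_feasible E z (Y $ i0 $ i0) Y" using T_iff Y by blast
    show "Y $ i0 $ i0 \<le> \<mu>'" if "polar_feasible E z \<mu>' Y'" for \<mu>' Y'
      using T_iff[OF Y(1)] Y(2)[of Y'] T_I[OF that] by (cases "\<mu>' \<le> M") auto
  qed
qed

text \<open>Value 0 forces a zero diagonal, hence \<open>Y = 0\<close>, and then \<open>z\<close>
  vanishes on \<open>E\<close>.\<close>

lemma polar_feasible_pos:
  assumes "simple_graph E" "z \<in> nonneg_vecs E" "z \<noteq> zero_vec E" "polar_feasible E z \<mu> Y"
  shows "0 < \<mu>"
proof (rule ccontr)
  assume "\<not> 0 < \<mu>"
  then have "\<mu> = 0" using polar_feasible_nonneg assms by force
  then have Y: "psd Y" "\<And>i. Y $ i $ i = 0" "\<And>e. e \<in> E \<Longrightarrow> z e \<le> edge_val Y e / 4"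
    using assms(4) by (auto simp: polar_feasible_def diag_def vec_eq_iff)
  have "Y $ i $ j = 0" for i j using psd_entry_bound[OF Y(1), of i j] Y(2) by simp
  then have "Y = 0" by (simp add: vec_eq_iff)
  then have "z e = 0" if "e \<in> E" for e
    using Y(3)[OF that] assms(2) that by (auto simp: edge_val_zero nonneg_vecs_def PiE_def Pi_def intro: antisym)
  then have "z = zero_vec E"
    using assms(2) by (auto simp: zero_vec_def nonneg_vecs_def fun_eq_iff restrict_def PiE_def extensional_def)
  with assms(3) show False by simp
qed

section \<open>Separation and strong duality\<close>

lemma convex_coneI:
  assumes "\<And>x y. x \<in> K \<Longrightarrow> y \<in> K \<Longrightarrow> x + y \<in> K" "\<And>c x. 0 \<le> c \<Longrightarrow> x \<in> K \<Longrightarrow> c *\<^sub>R x \<in> K"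
  shows "convex K"
  using assms by (simp add: convex_def)

text \<open>A negative value could be scaled to \<open>- (\<bar>b\<bar> + 1)\<close>, which lies
  below the bound \<open>b\<close>.\<close>

lemma cone_inner_nonneg:
  fixes a :: "'a::real_inner"
  assumes cone: "\<And>c x. 0 \<le> c \<Longrightarrow> x \<in> K \<Longrightarrow> c *\<^sub>R x \<in> K"
    and bound: "\<And>x. x \<in> K \<Longrightarrow> b \<le> a \<bullet> x" and x: "x \<in> K"
  shows "0 \<le> a \<bullet> x"
proof (rule ccontr)
  assume neg: "\<not> 0 \<le> a \<bullet> x"
  define t where "t = (\<bar>b\<bar> + 1) / - (a \<bullet> x)"
  have "b \<le> a \<bullet> (t *\<^sub>R x)" using neg
    by (intro bound cone x) (auto simp: t_def intro!: divide_nonneg_pos simp del: divide_minus_right)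
  also have "\<dots> = - (\<bar>b\<bar> + 1)" using neg by (simp add: t_def)
  finally show False by simp
qed

text \<open>The slack form of the program defining the polar value: a separating functional at its optimum
  carries both the weights \<open>w\<close> (on the second component) and the dual solution \<open>x\<close> (on the first).\<close>

definition polar_cone :: "'v::finite set set \<Rightarrow> ((real^'v) \<times> (real^('v set)) \<times> real) set" where
  "polar_cone E = {(d, v, m). \<exists>\<mu> Y. psd Y \<and> d = \<mu> *\<^sub>R 1 - diag Y
    \<and> (\<forall>e\<in>E. v $ e \<le> edge_val Y e / 4) \<and> \<mu> \<le> m}"

lemma diag_add: "diag (X + Y) = diag X + diag Y"
  by (simp add: diag_def vec_eq_iff)

lemma diag_scaleR: "diag (c *\<^sub>R Y) = c *\<^sub>R diag Y"
  by (simp add: diag_def vec_eq_iff)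

lemma polar_cone_add:
  assumes "p \<in> polar_cone E" "q \<in> polar_cone E" shows "p + q \<in> polar_cone E"
proof -
  obtain d v m \<mu> Y where p: "p = (d, v, m)" "psd Y" "d = \<mu> *\<^sub>R 1 - diag Y"
    "\<And>e. e \<in> E \<Longrightarrow> v $ e \<le> edge_val Y e / 4" "\<mu> \<le> m"
    using assms(1) by (auto simp: polar_cone_def)
  obtain d' v' m' \<mu>' Y' where q: "q = (d', v', m')" "psd Y'" "d' = \<mu>' *\<^sub>R 1 - diag Y'"
    "\<And>e. e \<in> E \<Longrightarrow> v' $ e \<le> edge_val Y' e / 4" "\<mu>' \<le> m'"
    using assms(2) by (auto simp: polar_cone_def)
  have "v $ e + v' $ e \<le> edge_val (Y + Y') e / 4" if "e \<in> E" for e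
    using p(4)[OF that] q(4)[OF that] by (simp add: edge_val_add)
  then show ?thesis
    using p q by (auto simp: polar_cone_def diag_add psd_add algebra_simps intro!: exI[of _ "\<mu> + \<mu>'"] exI[of _ "Y + Y'"])
qed

lemma polar_cone_scaleR:
  assumes "0 \<le> c" "p \<in> polar_cone E" shows "c *\<^sub>R p \<in> polar_cone E"
proof -
  obtain d v m \<mu> Y where p: "p = (d, v, m)" "psd Y" "d = \<mu> *\<^sub>R 1 - diag Y"
    "\<And>e. e \<in> E \<Longrightarrow> v $ e \<le> edge_val Y e / 4" "\<mu> \<le> m"
    using assms(2) by (auto simp: polar_cone_def)
  have "c * v $ e \<le> edge_val (c *\<^sub>R Y) e / 4" if "e \<in> E" for e
    using mult_left_mono[OF p(4)[OF that] assms(1)] by (simp add: edge_val_scaleR)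
  then show ?thesis
    using p assms(1)
    by (auto simp: polar_cone_def diag_scaleR psd_scaleR mult_left_mono scaleR_right_diff_distrib
        intro!: exI[of _ "c * \<mu>"] exI[of _ "c *\<^sub>R Y"])
qed

text \<open>Evaluating the separating functional \<open>(a, b, \<tau>)\<close> on special members of
  the cone reveals its parts: \<open>- b\<close> on \<open>E\<close> is \<open>w\<close>,
  \<open>- a\<close> is \<open>x\<close>, and \<open>\<tau>\<close> is the sum of the entries of
  \<open>x\<close>.\<close>

lemma polar_duality:
  fixes E :: "'v::finite set set"
  assumes graph: "simple_graph E" and z: "z \<in> nonneg_vecs E" "z \<noteq> zero_vec E"
    and feas: "polar_feasible E z \<mu> Y"
    and min: "\<And>\<mu>' Y'. polar_feasible E z \<mu>' Y' \<Longrightarrow> \<mu> \<le> \<mu>'"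
  obtains w x where "w \<in> nonneg_vecs E" "0 < (\<Sum>i\<in>UNIV. x $ i)"
    "(\<Sum>e\<in>E. w e * z e) = (\<Sum>i\<in>UNIV. x $ i) * \<mu>"
    "\<And>X. psd X \<Longrightarrow> mat_inner ((1/4) *\<^sub>R laplacian E w) X \<le> x \<bullet> diag X"
proof -
  \<comment> \<open>Coordinates outside \<open>E\<close> are unconstrained in the cone, so any
    filler would do; this freedom later forces \<open>b\<close> to vanish there.\<close>
  define \<zeta> :: "real^('v set)" where "\<zeta> = (\<chi> e. if e \<in> E then z e else 0)"
  let ?K = "polar_cone E"
  \<comment> \<open>The ray of values strictly below the optimum; by minimality of
    \<open>\<mu>\<close> it misses the cone.\<close>
  define S :: "((real^'v) \<times> (real^('v set)) \<times> real) set" where "S = {0} \<times> {\<zeta>} \<times> {..<\<mu>}"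
  have mem: "(\<nu> *\<^sub>R 1 - diag X, v, m) \<in> ?K" if "psd X" "\<And>e. e \<in> E \<Longrightarrow> v $ e \<le> edge_val X e / 4" "\<nu> \<le> m" for \<nu> X v m
    using that by (auto simp: polar_cone_def)
  have diag0: "diag 0 = (0 :: real^'v)" by (simp add: diag_def vec_eq_iff)
  have K0: "0 \<in> ?K"
    using mem[OF psd_zero, of 0 0 0] by (simp add: edge_val_zero diag0 zero_prod_def)
  have "S \<inter> ?K = {}"
  proof -
    have False if m: "(0, \<zeta>, m) \<in> ?K" "m < \<mu>" for m
    proof -
      obtain \<nu> X where X: "psd X" "0 = \<nu> *\<^sub>R 1 - diag X" "\<And>e. e \<in> E \<Longrightarrow> \<zeta> $ e \<le> edge_val X e / 4" "\<nu> \<le> m"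
        using m(1) by (auto simp: polar_cone_def)
      then have "polar_feasible E z \<nu> X" by (auto simp: polar_feasible_def \<zeta>_def)
      with min[of \<nu> X] X(4) m(2) show False by simp
    qed
    then show ?thesis by (auto simp: S_def)
  qed
  moreover have "convex S" unfolding S_def by (intro convex_Times) auto
  moreover have "convex ?K" by (intro convex_coneI polar_cone_add polar_cone_scaleR)
  moreover have "S \<noteq> {}" using lt_ex by (auto simp: S_def)
  ultimately obtain \<phi> c where \<phi>: "\<phi> \<noteq> 0" and S: "\<And>p. p \<in> S \<Longrightarrow> \<phi> \<bullet> p \<le> c" and K: "\<And>p. p \<in> ?K \<Longrightarrow> c \<le> \<phi> \<bullet> p"
    using separating_hyperplane_sets[of S ?K] K0 by blast
  obtain a b \<tau> where ab: "\<phi> = (a, b, \<tau>)" by (metis surj_pair)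
  have nonneg: "0 \<le> a \<bullet> d + b \<bullet> v + \<tau> * m" if "(d, v, m) \<in> ?K" for d v m
    using cone_inner_nonneg[OF polar_cone_scaleR K that] by (simp add: ab)
  have "c \<le> 0" using K[OF K0] by simp
  have "0 \<le> \<tau>"
    using nonneg[OF mem[OF psd_zero, of 0 0 1]] by (simp add: edge_val_zero diag0)
  \<comment> \<open>The scalar in the cone is free in sign, so testing it at 1 and at -1 with
    \<open>Y = 0\<close> yields an equality.\<close>
  have a1: "(\<Sum>i\<in>UNIV. a $ i) = - \<tau>"
  proof -
    have "a \<bullet> 1 = (\<Sum>i\<in>UNIV. a $ i)" by (simp add: inner_vec_def)
    then show ?thesis
      using nonneg[OF mem[OF psd_zero, of 0 1 1]] nonneg[OF mem[OF psd_zero, of 0 "-1" "-1"]]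
      by (simp add: edge_val_zero diag0)
  qed
  \<comment> \<open>With \<open>Y = 0\<close> the cone contains multiples of a coordinate vector:
    nonpositive ones for edges, all of them otherwise.\<close>
  have b_axis: "0 \<le> t * b $ e" if "e \<in> E \<Longrightarrow> t \<le> 0" for e t
  proof -
    have "(t *\<^sub>R axis e 1 :: real^('v set)) $ e' \<le> edge_val (0 :: real^'v^'v) e' / 4" if "e' \<in> E" for e'
      using \<open>e \<in> E \<Longrightarrow> t \<le> 0\<close> that by (auto simp: edge_val_zero axis_def)
    from nonneg[OF mem[OF psd_zero this, of 0 0]] show ?thesis by (simp add: diag0 inner_axis)
  qed
  have b_E: "b $ e \<le> 0" if "e \<in> E" for e using b_axis[of e "-1"] by simp
  have b_notE: "b $ e = 0" if "e \<notin> E" for e using b_axis[of e 1] b_axis[of e "-1"] that by simp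
  define w where "w = (\<lambda>e\<in>E. - b $ e)"
  have b_inner: "b \<bullet> v = - (\<Sum>e\<in>E. w e * v $ e)" for v
  proof -
    have "b \<bullet> v = (\<Sum>e\<in>E. b $ e * v $ e)"
      unfolding inner_vec_def by (rule sum.mono_neutral_cong_right) (auto simp: b_notE)
    then show ?thesis by (simp add: w_def flip: sum_negf)
  qed
  have w: "w \<in> nonneg_vecs E" using b_E by (simp add: w_def nonneg_vecs_def)
  have wz: "b \<bullet> \<zeta> = - (\<Sum>e\<in>E. w e * z e)" by (simp add: b_inner \<zeta>_def)
  \<comment> \<open>The test member has scalar 0 and no slack in the edge constraints, so its first
    component is \<open>- diag X\<close>.\<close>
  have dual: "mat_inner ((1/4) *\<^sub>R laplacian E w) X \<le> (- a) \<bullet> diag X" if "psd X" for X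
    using nonneg[OF mem[OF that, of "\<chi> e. edge_val X e / 4" 0 0]]
    by (simp add: b_inner mat_inner_laplacian)
  have "(\<Sum>e\<in>E. w e * z e) \<le> \<tau> * \<mu>"
  proof -
    have "(0, \<zeta>, \<mu>) \<in> ?K"
      using mem[of Y \<zeta> \<mu> \<mu>] feas by (simp add: polar_feasible_def \<zeta>_def)
    then show ?thesis using nonneg[of 0 \<zeta> \<mu>] by (simp add: wz)
  qed
  moreover have "\<tau> * \<mu> \<le> (\<Sum>e\<in>E. w e * z e)"
  proof (rule field_le_epsilon)
    fix \<epsilon> :: real assume "0 < \<epsilon>"
    \<comment> \<open>\<open>S\<close> excludes \<open>\<mu>\<close> itself and is approached from
      below; adding 1 keeps the denominator positive, as \<open>\<tau>\<close> may still be
      0.\<close>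
    define \<delta> where "\<delta> = \<epsilon> / (\<tau> + 1)"
    have \<delta>: "0 < \<delta>" "\<tau> * \<delta> \<le> \<epsilon>"
      using \<open>0 < \<epsilon>\<close> \<open>0 \<le> \<tau>\<close> by (auto simp: \<delta>_def field_simps)
    then have "(0, \<zeta>, \<mu> - \<delta>) \<in> S" by (simp add: S_def)
    then have "b \<bullet> \<zeta> + \<tau> * (\<mu> - \<delta>) \<le> 0" using S \<open>c \<le> 0\<close> by (fastforce simp: ab)
    then show "\<tau> * \<mu> \<le> (\<Sum>e\<in>E. w e * z e) + \<epsilon>"
      using \<delta> wz by (simp add: algebra_simps)
  qed
  ultimately have eq: "(\<Sum>e\<in>E. w e * z e) = \<tau> * \<mu>" by simp
  \<comment> \<open>If \<open>\<tau> = 0\<close>, the dual inequality at \<open>P i\<close> bounds a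
    nonnegative sum by \<open>- a $ i\<close>; these entries add up to 0, so \<open>a = 0\<close>.
    As \<open>P i\<close> has value 1 on each edge at \<open>i\<close>, also \<open>b = 0\<close>,
    contradicting \<open>\<phi> \<noteq> 0\<close>.\<close>
  have "\<tau> \<noteq> 0"
  proof
    assume "\<tau> = 0"
    define P where "P i = outer (axis i 1) (axis i 1 :: real^'v)" for i
    have wE: "0 \<le> w e" if "e \<in> E" for e using b_E that by (simp add: w_def)
    have P: "0 \<le> w e * (edge_val (P i) e / 4)" if "e \<in> E" for e i
      using wE[OF that] edge_val_nonneg[OF psd_outer, of "axis i 1" e] by (simp add: P_def)
    have Pa: "(- a) \<bullet> diag (P i) = - a $ i" for i
    proof -
      have "diag (P i) = axis i 1" by (simp add: P_def diag_def outer_def axis_def vec_eq_iff)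
      then show ?thesis by (simp add: inner_axis)
    qed
    have le: "(\<Sum>e\<in>E. w e * (edge_val (P i) e / 4)) \<le> - a $ i" for i
    proof -
      have "psd (P i)" by (simp add: P_def psd_outer)
      from dual[OF this] show ?thesis unfolding Pa mat_inner_laplacian .
    qed
    have "0 \<le> - a $ i" for i by (rule order_trans[OF _ le[of i]]) (intro sum_nonneg P)
    moreover have "(\<Sum>i\<in>UNIV. - a $ i) = 0" using a1 \<open>\<tau> = 0\<close> by (simp add: sum_negf)
    ultimately have ai: "a $ i = 0" for i
      using sum_nonneg_eq_0_iff[of UNIV "\<lambda>i. - a $ i"] by simp
    have "b $ e = 0" for e
    proof (cases "e \<in> E")
      case True
      obtain i j where e: "e = {i, j}" "i \<noteq> j" by (rule simple_graph_edgeE[OF graph True])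
      have "edge_val (P i) e = 1"
        using e(2) by (simp add: e(1) edge_val_doubleton laplacian_adj_def P_def outer_def axis_def)
      moreover have "w e * (edge_val (P i) e / 4) \<le> (\<Sum>e\<in>E. w e * (edge_val (P i) e / 4))"
        using P by (intro member_le_sum True) auto
      ultimately have "w e \<le> 0" using le[of i] ai[of i] by simp
      then show ?thesis using True b_E[OF True] by (simp add: w_def)
    qed (rule b_notE)
    then have "a = 0" "b = 0" using ai by (auto simp: vec_eq_iff)
    with \<phi> ab \<open>\<tau> = 0\<close> show False by (simp add: zero_prod_def)
  qed
  then have "0 < \<tau>" using \<open>0 \<le> \<tau>\<close> by simp
  moreover have "(\<Sum>i\<in>UNIV. (- a) $ i) = \<tau>" using a1 by (simp add: sum_negf)
  ultimately show thesis using that[of w "- a"] w eq dual by simp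
qed

lemma GW_polar_eq:
  assumes graph: "simple_graph E" and feas: "polar_feasible E z \<mu> Y"
    and min: "\<And>\<mu>' Y'. polar_feasible E z \<mu>' Y' \<Longrightarrow> \<mu> \<le> \<mu>'"
  shows "GW_polar E z = \<mu>"
  unfolding GW_polar_def edge_constraint_iff[OF graph]
proof (rule Least_equality)
  show "0 \<le> \<mu> \<and> (\<exists>Y. psd Y \<and> diag Y = \<mu> *\<^sub>R 1 \<and> (\<forall>e\<in>E. z e \<le> edge_val Y e / 4))"
    using feas polar_feasible_nonneg[OF feas] by (auto simp: polar_feasible_def)
qed (use min in \<open>auto simp: polar_feasible_def\<close>)

text \<open>Weak duality bounds the program by the sum of \<open>x\<close>. The matrix
  \<open>Y / \<mu>\<close> attains this bound, since feasibility of \<open>Y\<close> makes its value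
  at least \<open>w\<close> paired with \<open>z / \<mu>\<close>.\<close>

lemma GW_eq:
  assumes w: "w \<in> nonneg_vecs E" and feas: "polar_feasible E z \<mu> Y" and "0 < \<mu>"
    and wz: "(\<Sum>e\<in>E. w e * z e) = (\<Sum>i\<in>UNIV. x $ i) * \<mu>"
    and dual: "\<And>X. psd X \<Longrightarrow> mat_inner ((1/4) *\<^sub>R laplacian E w) X \<le> x \<bullet> diag X"
  shows "GW E w = (\<Sum>i\<in>UNIV. x $ i)"
  unfolding GW_def
proof (rule Greatest_equality)
  have upper: "mat_inner ((1/4) *\<^sub>R laplacian E w) X \<le> (\<Sum>i\<in>UNIV. x $ i)" if "psd X" "diag X = 1" for X
    using dual[OF that(1)] that(2) by (simp add: inner_vec_def)
  then show "v \<le> (\<Sum>i\<in>UNIV. x $ i)"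
    if "\<exists>X. psd X \<and> diag X = 1 \<and> v = mat_inner ((1/4) *\<^sub>R laplacian E w) X" for v
    using that by blast
  define X where "X = (1 / \<mu>) *\<^sub>R Y"
  have X: "psd X" "diag X = 1"
    using feas \<open>0 < \<mu>\<close> by (auto simp: X_def polar_feasible_def psd_scaleR diag_scaleR)
  have "(\<Sum>i\<in>UNIV. x $ i) = (\<Sum>e\<in>E. w e * z e) / \<mu>" using wz \<open>0 < \<mu>\<close> by simp
  also have "\<dots> \<le> (\<Sum>e\<in>E. w e * (edge_val Y e / 4)) / \<mu>"
    using feas \<open>0 < \<mu>\<close> w
    by (intro divide_right_mono sum_mono mult_left_mono) (auto simp: polar_feasible_def nonneg_vecs_def PiE_def Pi_def)
  also have "\<dots> = mat_inner ((1/4) *\<^sub>R laplacian E w) X"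
    by (simp add: X_def mat_inner_laplacian edge_val_scaleR sum_divide_distrib mult.commute)
  finally show "\<exists>X. psd X \<and> diag X = 1 \<and> (\<Sum>i\<in>UNIV. x $ i) = mat_inner ((1/4) *\<^sub>R laplacian E w) X"
    using X upper[OF X] by (intro exI[of _ X]) simp
qed

subsection \<open>Rounding\<close>

text \<open>The unit diagonal makes the Gram vectors unit vectors; on an edge, a quarter of its
  value is \<open>(1 - Y $ i $ j) / 2\<close>, which \<open>alpha_GW_arccos\<close> compares with
  the separation probability.\<close>

lemma hyperplane_rounding:
  fixes Y :: "real^'v^'v::finite"
  assumes "simple_graph E" "psd Y" "diag Y = 1"
  obtains p :: "'v set \<Rightarrow> real" where "\<And>U. 0 \<le> p U" "(\<Sum>U\<in>UNIV. p U) = 1"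
    "\<And>e. e \<in> E \<Longrightarrow> alpha_GW * (edge_val Y e / 4) \<le> (\<Sum>U\<in>UNIV. p U * indicator (cut_edges E U) e)"
proof -
  obtain u :: "'v \<Rightarrow> real^('v bit0)" where u: "\<And>i j. Y $ i $ j = u i \<bullet> u j"
    using psd_gram[OF assms(2)] by blast
  have Y1: "Y $ i $ i = 1" for i using assms(3) by (simp add: diag_def vec_eq_iff)
  then have norm: "norm (u i) = 1" for i using u[of i i] by (simp add: norm_eq_1)
  obtain p :: "'v set \<Rightarrow> real" where p: "\<And>U. 0 \<le> p U" "(\<Sum>U\<in>UNIV. p U) = 1"
    and sep: "\<And>i j. (\<Sum>U | (i \<in> U) \<noteq> (j \<in> U). p U) = arccos (u i \<bullet> u j) / pi"
    using cut_distribution_exists[of u] norm by blast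
  show thesis
  proof (rule that[OF p])
    fix e assume e: "e \<in> E"
    obtain i j where ij: "e = {i, j}" "i \<noteq> j" by (rule simple_graph_edgeE[OF assms(1) e])
    have "(\<Sum>U\<in>UNIV. p U * indicator (cut_edges E U) e) = (\<Sum>U | (i \<in> U) \<noteq> (j \<in> U). p U)"
    proof (rule sum.mono_neutral_cong_right)
      have "e \<in> cut_edges E U \<longleftrightarrow> (i \<in> U) \<noteq> (j \<in> U)" for U
        using e ij by (auto simp: cut_edges_def Int_insert_left)
      then show "\<forall>U\<in>UNIV - {U. (i \<in> U) \<noteq> (j \<in> U)}. p U * indicator (cut_edges E U) e = 0"
        and "\<And>U. U \<in> {U. (i \<in> U) \<noteq> (j \<in> U)} \<Longrightarrow> p U * indicator (cut_edges E U) e = p U"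
        by (auto simp: indicator_def)
    qed auto
    moreover have "\<bar>Y $ i $ j\<bar> \<le> 1" using psd_entry_bound[OF assms(2), of i j] by (simp add: Y1)
    moreover have "edge_val Y e / 4 = (1 - Y $ i $ j) / 2"
      using ij(2) psd_sym[OF assms(2), of i j] by (simp add: ij(1) edge_val_doubleton laplacian_adj_def Y1)
    ultimately show "alpha_GW * (edge_val Y e / 4) \<le> (\<Sum>U\<in>UNIV. p U * indicator (cut_edges E U) e)"
      using alpha_GW_arccos[of "Y $ i $ j"] sep[of i j] u[of i j] by metis
  qed
qed

lemma weighted_mean_le_some:
  fixes p c :: "'a::finite \<Rightarrow> real"
  assumes "\<And>a. 0 \<le> p a" "(\<Sum>a\<in>UNIV. p a) = 1"
  obtains a where "(\<Sum>b\<in>UNIV. p b * c b) \<le> c a"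
proof -
  have "Max (range c) \<in> range c" by (intro Max_in) auto
  then obtain a where a: "Max (range c) = c a" by (metis rangeE)
  have "c b \<le> c a" for b unfolding a[symmetric] by (intro Max_ge) auto
  then have "(\<Sum>b\<in>UNIV. p b * c b) \<le> (\<Sum>b\<in>UNIV. p b * c a)"
    using assms(1) by (intro sum_mono mult_left_mono)
  also have "\<dots> = c a" by (simp add: assms(2) flip: sum_distrib_right)
  finally show thesis by (rule that)
qed

section \<open>Assembly of the certificate\<close>

theorem theorem20:
  fixes E :: "'v::finite set set" and z :: "'v set \<Rightarrow> real"
  assumes "simple_graph E"
    and "z \<in> nonneg_vecs E"
    and "z \<noteq> zero_vec E"
  shows "\<exists>w \<rho> \<mu> S y x. w \<in> tight_weights E z \<and> w \<noteq> zero_vec E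
    \<and> certificate E alpha_GW w z \<rho> \<mu> S y x"
proof -
  obtain \<mu> Y where feas: "polar_feasible E z \<mu> Y" and min: "\<And>\<mu>' Y'. polar_feasible E z \<mu>' Y' \<Longrightarrow> \<mu> \<le> \<mu>'"
    using polar_minimizer_exists[OF assms(1,2)] by blast
  have "0 < \<mu>" using polar_feasible_pos[OF assms feas] .
  obtain w x where w: "w \<in> nonneg_vecs E" and pos: "0 < (\<Sum>i\<in>UNIV. x $ i)"
    and wz: "(\<Sum>e\<in>E. w e * z e) = (\<Sum>i\<in>UNIV. x $ i) * \<mu>"
    and dual: "\<And>X. psd X \<Longrightarrow> mat_inner ((1/4) *\<^sub>R laplacian E w) X \<le> x \<bullet> diag X"
    by (rule polar_duality[OF assms feas], erule min, blast)
  define \<rho> where "\<rho> = (\<Sum>i\<in>UNIV. x $ i)"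
  have w_nonneg: "0 \<le> w e" if "e \<in> E" for e
    using w that by (auto simp: nonneg_vecs_def PiE_def Pi_def)
  have tight: "w \<in> tight_weights E z"
    using w wz GW_polar_eq[OF assms(1) feas min] GW_eq[OF w feas \<open>0 < \<mu>\<close> wz dual]
    by (simp add: tight_weights_def)
  have "w \<noteq> zero_vec E"
    using wz pos \<open>0 < \<mu>\<close> by (auto simp: zero_vec_def)
  define X where "X = (1 / \<mu>) *\<^sub>R Y"
  have X: "psd X" "diag X = 1"
    using feas \<open>0 < \<mu>\<close> by (auto simp: X_def polar_feasible_def psd_scaleR diag_scaleR)
  obtain p :: "'v set \<Rightarrow> real" where p: "\<And>U. 0 \<le> p U" "(\<Sum>U\<in>UNIV. p U) = 1"
    and cut: "\<And>e. e \<in> E \<Longrightarrow> alpha_GW * (edge_val X e / 4) \<le> (\<Sum>U\<in>UNIV. p U * indicator (cut_edges E U) e)"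
    using hyperplane_rounding[OF assms(1) X] by blast
  have cut_z: "alpha_GW * (z e / \<mu>) \<le> (\<Sum>U\<in>UNIV. p U * indicator (cut_edges E U) e)" if "e \<in> E" for e
  proof -
    have "z e / \<mu> \<le> edge_val X e / 4"
      using feas that \<open>0 < \<mu>\<close> by (auto simp: X_def edge_val_scaleR polar_feasible_def field_simps)
    then have "alpha_GW * (z e / \<mu>) \<le> alpha_GW * (edge_val X e / 4)"
      using alpha_GW_bounds by (intro mult_left_mono) auto
    with cut[OF that] show ?thesis by linarith
  qed
  \<comment> \<open>The factor cancels \<open>alpha_GW / \<mu>\<close> in \<open>cut_z\<close>;
    since \<open>p\<close> has total mass 1, the bound on the mass of \<open>y\<close> holds with
    equality.\<close>
  define y where "y U = \<mu> / alpha_GW * p U" for U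
  define c where "c U = (\<Sum>e\<in>E. w e * indicator (cut_edges E U) e)" for U
  obtain S where S: "(\<Sum>U\<in>UNIV. p U * c U) \<le> c S" using weighted_mean_le_some[OF p] by blast
  \<comment> \<open>Pairing \<open>cut_z\<close> with \<open>w\<close> shows that the mean cut
    weight under \<open>p\<close> is at least \<open>alpha_GW * \<rho>\<close>.\<close>
  have "alpha_GW * \<rho> = (\<Sum>e\<in>E. w e * (alpha_GW * (z e / \<mu>)))"
  proof -
    have "\<rho> = (\<Sum>e\<in>E. w e * z e) / \<mu>" using wz \<open>0 < \<mu>\<close> by (simp add: \<rho>_def)
    then show ?thesis by (simp add: sum_divide_distrib sum_distrib_left algebra_simps)
  qed
  also have "\<dots> \<le> (\<Sum>e\<in>E. w e * (\<Sum>U\<in>UNIV. p U * indicator (cut_edges E U) e))"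
    using cut_z w_nonneg by (intro sum_mono mult_left_mono) auto
  also have "\<dots> = (\<Sum>U\<in>UNIV. p U * c U)"
    unfolding c_def sum_distrib_left by (subst sum.swap) (simp add: mult.left_commute)
  finally have cut_S: "alpha_GW * \<rho> \<le> c S" using S by linarith
  have y_nonneg: "0 \<le> y U" for U using p \<open>0 < \<mu>\<close> alpha_GW_bounds by (simp add: y_def)
  have y_sum: "(\<Sum>U\<in>UNIV. y U) = 1 / alpha_GW * \<mu>"
    unfolding y_def sum_distrib_left[symmetric] p by simp
  have y_cover: "z e \<le> (\<Sum>U\<in>UNIV. y U * indicator (cut_edges E U) e)" if "e \<in> E" for e
  proof -
    have "z e = \<mu> / alpha_GW * (alpha_GW * (z e / \<mu>))" using \<open>0 < \<mu>\<close> alpha_GW_bounds by simp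
    also have "\<dots> \<le> \<mu> / alpha_GW * (\<Sum>U\<in>UNIV. p U * indicator (cut_edges E U) e)"
      using cut_z[OF that] \<open>0 < \<mu>\<close> alpha_GW_bounds by (intro mult_left_mono) auto
    finally show ?thesis unfolding y_def sum_distrib_left by (simp only: mult.assoc)
  qed
  have "certificate E alpha_GW w z \<rho> \<mu> S y x"
    unfolding certificate_def
    using alpha_GW_bounds w assms(2,3) \<open>0 < \<mu>\<close> pos wz cut_S y_nonneg y_sum y_cover Diag_ge_laplacian[OF dual]
    by (auto simp: \<rho>_def c_def)
  with tight \<open>w \<noteq> zero_vec E\<close> show ?thesis by blast
qed

end
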